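(* Let $X$ be an infinite set. Then $Top(X)$ is not a $G_\delta$ set in $2^{\mathcal{P}(X)}$.
   Context: $2^{\mathcal{P}(X)}$ is the set $\mathcal{P}(\mathcal{P}(X))$ of all families of subsets of $X$ with the product topology ($2=\{0,1\}$ discrete); a subbase of open sets is given by $A^+ = \{x : A \in x\}$ and $A^- = \{x : A \notin x\}$ for $A \subseteq X$. $Top(X) \subseteq 2^{\mathcal{P}(X)}$ is the set of all topologies on $X$ (each topology regarded as its family of open sets). *)

theory Defs
  imports "HOL-Analysis.Analysis"
begin

text \<open>Families of subsets of \<open>X\<close> are identified with their characteristic functions
  \<open>Pow X \<rightarrow> bool\<close>. As usual for \<^const>\<open>product_topology\<close>, these are extensional functions,
  whence the \<^const>\<open>restrict\<close>.\<close>

definition char_family :: "'a set \<Rightarrow> 'a set set \<Rightarrow> 'a set \<Rightarrow> bool"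
  where "char_family X F = (\<lambda>A\<in>Pow X. A \<in> F)"

text \<open>The space \<open>2\<close> to the power \<open>Pow X\<close>, carried by \<open>Pow (Pow X)\<close>.\<close>

definition families_topology :: "'a set \<Rightarrow> 'a set set topology"
  where "families_topology X =
    pullback_topology (Pow (Pow X)) (char_family X)
      (product_topology (\<lambda>_. discrete_topology (UNIV :: bool set)) (Pow X))"

definition Top :: "'a set \<Rightarrow> 'a set set set"
  where "Top X = {{U. openin T U} | T. topspace T = X}"

lemma char_family_in_PiE: "char_family X F \<in> Pow X \<rightarrow>\<^sub>E UNIV"
  by (auto simp: char_family_def)

lemma topspace_families_topology [simp]: "topspace (families_topology X) = Pow (Pow X)"
  by (auto simp: families_topology_def topspace_pullback_topology char_family_def)

lemma bij_betw_char_family: "bij_betw (char_family X) (Pow (Pow X)) (Pow X \<rightarrow>\<^sub>E UNIV)"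
proof (rule bij_betw_byWitness [where f' = "\<lambda>g. {A \<in> Pow X. g A}"])
  show "\<forall>F \<in> Pow (Pow X). {A \<in> Pow X. char_family X F A} = F"
    by (auto simp: char_family_def)
  show "\<forall>g \<in> Pow X \<rightarrow>\<^sub>E UNIV. char_family X {A \<in> Pow X. g A} = g"
  proof
    fix g :: "'a set \<Rightarrow> bool" assume g: "g \<in> Pow X \<rightarrow>\<^sub>E UNIV"
    show "char_family X {A \<in> Pow X. g A} = g"
    proof
      fix A show "char_family X {A \<in> Pow X. g A} A = g A"
        using PiE_arb [OF g, of A] by (cases "A \<in> Pow X") (simp_all add: char_family_def)
    qed
  qed
  show "char_family X ` Pow (Pow X) \<subseteq> Pow X \<rightarrow>\<^sub>E UNIV"
    using char_family_in_PiE by (rule image_subsetI)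
  show "(\<lambda>g. {A \<in> Pow X. g A}) ` (Pow X \<rightarrow>\<^sub>E UNIV) \<subseteq> Pow (Pow X)"
    by (rule image_subsetI, rule PowI, rule Collect_restrict)
qed

lemma homeomorphic_map_char_family:
  "homeomorphic_map (families_topology X)
     (product_topology (\<lambda>_. discrete_topology (UNIV :: bool set)) (Pow X)) (char_family X)"
proof (rule bijective_open_imp_homeomorphic_map)
  let ?P = "product_topology (\<lambda>_. discrete_topology (UNIV :: bool set)) (Pow X)"
  show "continuous_map (families_topology X) ?P (char_family X)"
    using continuous_map_pullback [OF continuous_map_id [of ?P]]
    by (simp add: families_topology_def)
  have surj: "char_family X ` Pow (Pow X) = Pow X \<rightarrow>\<^sub>E UNIV"
    by (rule bij_betw_imp_surj_on [OF bij_betw_char_family])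
  then show "char_family X ` topspace (families_topology X) = topspace ?P"
    by simp
  show "inj_on (char_family X) (topspace (families_topology X))"
    using bij_betw_imp_inj_on [OF bij_betw_char_family] by simp
  show "open_map (families_topology X) ?P (char_family X)"
    unfolding open_map_def
  proof (intro allI impI)
    fix S assume "openin (families_topology X) S"
    then obtain U where U: "openin ?P U" "S = char_family X -` U \<inter> Pow (Pow X)"
      by (auto simp: families_topology_def openin_pullback_topology)
    have "topspace ?P = char_family X ` Pow (Pow X)"
      by (simp add: surj)
    with openin_subset [OF U(1)] have "U \<subseteq> char_family X ` Pow (Pow X)"
      by (rule back_subst)
    then have "char_family X ` S = U"
      unfolding U(2) by (intro equalityI subsetI) (elim imageE IntE vimageE, simp, drule (1) subsetD, elim imageE, simp)
    then show "openin ?P (char_family X ` S)"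
      using U(1) by simp
  qed
qed

lemma openin_families_topology_member:
  assumes "A \<subseteq> X"
  shows "openin (families_topology X) {F \<in> Pow (Pow X). A \<in> F}"
    and "openin (families_topology X) {F \<in> Pow (Pow X). A \<notin> F}"
proof -
  let ?P = "product_topology (\<lambda>_. discrete_topology (UNIV :: bool set)) (Pow X)"
  have "continuous_map (families_topology X) (discrete_topology UNIV) (\<lambda>F. char_family X F A)"
    using continuous_map_compose [OF homeomorphic_imp_continuous_map
        [OF homeomorphic_map_char_family] continuous_map_product_projection [of A "Pow X"]] assms
    by (simp add: comp_def)
  then have *: "openin (families_topology X) {F \<in> Pow (Pow X). char_family X F A \<in> B}" for B
    using openin_continuous_map_preimage [of "families_topology X" "discrete_topology UNIV" _ B] by simp
  show "openin (families_topology X) {F \<in> Pow (Pow X). A \<in> F}"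
    using * [of "{True}"] assms by (simp add: char_family_def)
  show "openin (families_topology X) {F \<in> Pow (Pow X). A \<notin> F}"
    using * [of "{False}"] assms by (simp add: char_family_def)
qed

lemma Top_subset: "Top X \<subseteq> Pow (Pow X)"
  by (auto simp: Top_def dest: openin_subset)

end

theory Submission
  imports Defs
begin

text \<open>The discrete topology \<open>Pow X\<close> is a point of \<open>Top X\<close> at which the \<open>G\<^sub>\<delta>\<close> property fails.
  A basic open set of the product \<open>2\<close> to the power \<open>Pow X\<close> constrains only finitely many
  coordinates, so a \<open>G\<^sub>\<delta>\<close> set containing a family \<open>F\<close> contains every family that agrees with \<open>F\<close>
  on a suitable countable collection \<open>C\<close> of subsets of \<open>X\<close>
  (\<open>gdelta_in_families_countable_support\<close>). If \<open>Top X\<close> were a \<open>G\<^sub>\<delta>\<close> set, this would apply with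
  \<open>F = Pow X\<close>. Cantor's diagonal argument gives a set \<open>A \<subseteq> X\<close> outside \<open>C\<close>
  that has at least two elements (\<open>diagonal_superset\<close>). Then \<open>Pow X - {A}\<close> agrees with \<open>Pow X\<close> on \<open>C\<close>,
  so it is a topology; but it contains every singleton and not the union \<open>A\<close> of the singletons below
  \<open>A\<close>, a contradiction.\<close>

lemma openin_families_finite_support:
  assumes "openin (families_topology X) U" "F \<in> U"
  shows "\<exists>C. finite C \<and> (\<forall>G. G \<subseteq> Pow X \<longrightarrow> G \<inter> C = F \<inter> C \<longrightarrow> G \<in> U)"
proof -
  let ?P = "product_topology (\<lambda>_. discrete_topology (UNIV :: bool set)) (Pow X)"
  obtain W where W: "openin ?P W" "U = char_family X -` W \<inter> Pow (Pow X)"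
    using assms(1) by (auto simp: families_topology_def openin_pullback_topology)
  then have "char_family X F \<in> W"
    using assms(2) by auto
  from product_topology_open_contains_basis [OF W(1) this] obtain V
    where V: "char_family X F \<in> (\<Pi>\<^sub>E A\<in>Pow X. V A)" "finite {A. V A \<noteq> UNIV}"
      "(\<Pi>\<^sub>E A\<in>Pow X. V A) \<subseteq> W"
    by auto
  show ?thesis
  proof (intro exI conjI allI impI)
    show "finite {A. V A \<noteq> UNIV}"
      by (rule V(2))
    fix G assume G: "G \<subseteq> Pow X" "G \<inter> {A. V A \<noteq> UNIV} = F \<inter> {A. V A \<noteq> UNIV}"
    have "char_family X G A \<in> V A" if "A \<in> Pow X" for A
    proof (cases "V A = UNIV")
      case False
      then have "char_family X G A = char_family X F A"
        using G(2) that by (auto simp: char_family_def)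
      then show ?thesis
        using PiE_mem [OF V(1) that] by simp
    qed simp
    then have "char_family X G \<in> (\<Pi>\<^sub>E A\<in>Pow X. V A)"
      by (auto simp: char_family_def)
    then show "G \<in> U"
      using V(3) W(2) G(1) by auto
  qed
qed

text \<open>A countable union of the finite supports of the preceding lemma, one for each open set in the
  intersection, is countable.\<close>

lemma gdelta_in_families_countable_support:
  assumes "gdelta_in (families_topology X) S" "F \<in> S"
  shows "\<exists>C. countable C \<and> (\<forall>G. G \<subseteq> Pow X \<longrightarrow> G \<inter> C = F \<inter> C \<longrightarrow> G \<in> S)"
proof -
  obtain \<U> where \<U>: "countable \<U>" "\<And>U. U \<in> \<U> \<Longrightarrow> openin (families_topology X) U" "\<Inter>\<U> = S"
    using assms(1) unfolding gdelta_in_alt intersection_of_def by blast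
  have "\<exists>C. finite C \<and> (\<forall>G. G \<subseteq> Pow X \<longrightarrow> G \<inter> C = F \<inter> C \<longrightarrow> G \<in> U)" if "U \<in> \<U>" for U
  proof -
    have "F \<in> U"
      using that \<U>(3) assms(2) by blast
    then show ?thesis
      by (rule openin_families_finite_support [OF \<U>(2) [OF that]])
  qed
  then obtain c where c: "\<And>U. U \<in> \<U> \<Longrightarrow> finite (c U)"
    "\<And>U G. U \<in> \<U> \<Longrightarrow> G \<subseteq> Pow X \<Longrightarrow> G \<inter> c U = F \<inter> c U \<Longrightarrow> G \<in> U"
    by metis
  show ?thesis
  proof (intro exI conjI allI impI)
    show "countable (\<Union>U\<in>\<U>. c U)"
      using \<U>(1) c(1) by (simp add: countable_finite)
    fix G assume G: "G \<subseteq> Pow X" "G \<inter> (\<Union>U\<in>\<U>. c U) = F \<inter> (\<Union>U\<in>\<U>. c U)"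
    have "G \<in> U" if "U \<in> \<U>" for U
      using G that by (intro c(2) [OF that]) blast+
    then show "G \<in> S"
      using \<U>(3) by blast
  qed
qed

text \<open>Cantor's diagonal argument, run along a sequence of distinct points of \<open>X - B\<close> so that the
  elements of \<open>B\<close> can be put into the diagonal set without disturbing it.\<close>

lemma diagonal_superset:
  assumes "infinite (X - B)" "B \<subseteq> X" "countable C"
  obtains A where "B \<subseteq> A" "A \<subseteq> X" "A \<notin> C"
proof -
  obtain f :: "nat \<Rightarrow> 'a" where f: "inj f" "range f \<subseteq> X - B"
    using infinite_countable_subset [OF assms(1)] by blast
  define A where "A = B \<union> {f n |n. f n \<notin> from_nat_into C n}"
  have "f n \<in> A \<longleftrightarrow> f n \<notin> from_nat_into C n" for n
    using f by (auto simp: A_def dest: injD)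
  then have "A \<noteq> from_nat_into C n" for n
    by metis
  then have "A \<notin> C"
    using subset_range_from_nat_into [OF assms(3)] by blast
  then show thesis
    using that [of A] f(2) assms(2) by (auto simp: A_def)
qed

lemma Pow_in_Top: "Pow X \<in> Top X"
proof -
  have "Pow X = {U. openin (discrete_topology X) U}"
    by auto
  then show ?thesis
    unfolding Top_def mem_Collect_eq
    by (intro exI [of _ "discrete_topology X"] conjI topspace_discrete_topology)
qed

lemma Top_Union_closed: "F \<in> Top X \<Longrightarrow> K \<subseteq> F \<Longrightarrow> \<Union>K \<in> F"
proof -
  assume "F \<in> Top X" "K \<subseteq> F"
  then obtain T where "F = {U. openin T U}"
    unfolding Top_def by blast
  with \<open>K \<subseteq> F\<close> show ?thesis
    by (simp add: openin_Union subset_eq)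
qed

theorem theorem4p2:
  fixes X :: "'a set"
  assumes "infinite X"
  shows "\<not> gdelta_in (families_topology X) (Top X)"
proof
  assume gdelta: "gdelta_in (families_topology X) (Top X)"
  obtain C where C: "countable C"
    "\<And>G. G \<subseteq> Pow X \<Longrightarrow> G \<inter> C = Pow X \<inter> C \<Longrightarrow> G \<in> Top X"
    using gdelta_in_families_countable_support [OF gdelta Pow_in_Top] by metis
  obtain a where a: "a \<in> X"
    using infinite_imp_nonempty [OF assms] by blast
  obtain b where b: "b \<in> X" "b \<noteq> a"
    using infinite_imp_nonempty [OF infinite_remove [OF assms, of a]] by blast
  have "infinite (X - {a, b})" "{a, b} \<subseteq> X"
    using assms a b(1) by simp_all
  then obtain A where A: "{a, b} \<subseteq> A" "A \<subseteq> X" "A \<notin> C"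
    using C(1) by (rule diagonal_superset)
  have "Pow X - {A} \<in> Top X"
    using A(3) by (intro C(2)) auto
  moreover have "(\<lambda>x. {x}) ` A \<subseteq> Pow X - {A}"
    using A b(2) by auto
  ultimately have "\<Union>((\<lambda>x. {x}) ` A) \<in> Pow X - {A}"
    by (rule Top_Union_closed)
  then show False
    by simp
qed

end
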